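(* Let $\zeta>0$ and $\xi$ be ordinals. Suppose that for each $c\in C(\mathcal{T}_{\zeta\xi})\cup\{\varnothing\}$ the function $f_c:C(\mathcal{T}_{\zeta\xi})\to\mathbb{R}$ is $\zeta$ small, and that for all $c,c'\in C(\mathcal{T}_{\zeta\xi})\cup\{\varnothing\}$ with $c<c'$ and all $c_1\in C(\mathcal{T}_{\zeta\xi})$, $f_c(c_1)\leqslant f_{c'}(c_1)$. Then for any $(\varepsilon_n)\subset(0,1)$ there exists an order preserving $j:\mathcal{MT}_\xi\to C(\mathcal{T}_{\zeta\xi})\cup\{\varnothing\}$ so that $j(\varnothing)=\varnothing$ and so that for each $s\in\mathcal{MT}_\xi$ and $t\in\mathcal{T}_\xi$ with $s\prec t$, $f_{j(s)}(j(t))\leqslant\varepsilon_{|t|}$. Moreover, if each $f_c$ is strictly $\zeta$ small, the result holds with $\varepsilon_n=0$ for all $n\in\mathbb{N}$.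
   Context: For a set $S$, $S^{<\omega}$ denotes the finite sequences in $S$, including $\varnothing$; $|s|$ is the length of $s$, $s^\frown t$ is concatenation, and $s\prec t$ means $s$ is a proper initial segment of $t$. A map $f:P\to Q$ between partially ordered sets is order preserving if $x<_Py$ implies $f(x)<_Qf(y)$ (only this implication); sets of sequences are ordered by $\prec$. Minimal trees: $\mathcal{MT}_0=\{\varnothing\}$, $\mathcal{MT}_{\xi+1}=\{\varnothing\}\cup\{(\xi+1)^\frown t:t\in\mathcal{MT}_\xi\}$, $\mathcal{MT}_\xi=\bigcup_{\zeta<\xi}\mathcal{MT}_{\zeta+1}$ for limit $\xi$, and $\mathcal{T}_\xi=\mathcal{MT}_\xi\setminus\{\varnothing\}$. Segments: for a set $U$ of finite sequences, $C(U)$ is the set of finite, non-empty subsets of $U\setminus\{\varnothing\}$ which are linearly ordered by $\prec$; for $c,c'\in C(U)$, $c<c'$ means $s\prec t$ for all $s\in c$, $t\in c'$. On $C(U)\cup\{\varnothing\}$ one also declares $\varnothing<c$ for each $c\in C(U)$. An order preserving map $i$ induces a map on segments by $i(c)=\{i(t):t\in c\}$. A function $f:C(\mathcal{T})\to\mathbb{R}$ is $\zeta$ small if for every order preserving $i:\mathcal{T}_\zeta\to\mathcal{T}$, $\inf\{f(i(c)):c\in C(\mathcal{T}_\zeta)\}\leqslant 0$; it is strictly $\zeta$ small if (in addition) this infimum is always a minimum. $\zeta\xi$ is the usual ordinal product, so $\zeta(\xi+1)=\zeta\xi+\zeta$. *)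

theory Defs
  imports Complex_Main "HOL-Library.FuncSet" "HOL-Library.Sublist" "HOL-Library.Extended_Real"
begin

text \<open>
  HOL has no type of all ordinals.  The type \<open>'a ordinal\<close> is the initial ordinal of cardinality
  the successor cardinal of \<open>max (card 'a) \<aleph>\<^sub>0\<close>: its elements are the ordinals of cardinality at
  most \<open>max (card 'a) \<aleph>\<^sub>0\<close>, each identified with the set of its predecessors.  A statement about
  \<open>'a ordinal\<close> for an arbitrary type \<open>'a\<close> covers every ordinal realised by a well-ordering of some HOL type; see
  \<open>ordinal_represents\<close> below.
\<close>

definition ord_rel :: "('a + nat) set rel" where
  "ord_rel = cardSuc (card_of (UNIV :: ('a + nat) set))"

lemma infinite_base: "\<not> finite (Field (card_of (UNIV :: ('a + nat) set)))"
  by (simp add: Field_card_of finite_Plus_UNIV_iff)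

lemma Card_order_ord_rel: "Card_order (ord_rel :: ('a + nat) set rel)"
  unfolding ord_rel_def by (rule cardSuc_Card_order) (rule card_of_Card_order)

lemma Well_order_ord_rel: "Well_order (ord_rel :: ('a + nat) set rel)"
  using Card_order_ord_rel card_order_on_well_order_on by blast

lemma infinite_Field_ord_rel: "\<not> finite (Field (ord_rel :: ('a + nat) set rel))"
  unfolding ord_rel_def using cardSuc_finite[OF card_of_Card_order] infinite_base by blast

typedef 'a ordinal = "Field (ord_rel :: ('a + nat) set rel)"
  using infinite_Field_ord_rel by (metis all_not_in_conv finite.emptyI)

instantiation ordinal :: (type) linorder
begin

definition less_eq_ordinal :: "'a ordinal \<Rightarrow> 'a ordinal \<Rightarrow> bool" where
  "\<alpha> \<le> \<beta> \<longleftrightarrow> (Rep_ordinal \<alpha>, Rep_ordinal \<beta>) \<in> ord_rel"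

definition less_ordinal :: "'a ordinal \<Rightarrow> 'a ordinal \<Rightarrow> bool" where
  "\<alpha> < \<beta> \<longleftrightarrow> \<alpha> \<le> \<beta> \<and> \<not> \<beta> \<le> (\<alpha> :: 'a ordinal)"

instance
proof
  note wo = Well_order_ord_rel[unfolded well_order_on_def linear_order_on_def
      partial_order_on_def preorder_on_def]
  fix x y z :: "'a ordinal"
  show "x < y \<longleftrightarrow> x \<le> y \<and> \<not> y \<le> x" by (rule less_ordinal_def)
  show "x \<le> x"
    using wo Rep_ordinal[of x] unfolding less_eq_ordinal_def refl_on_def by blast
  show "x \<le> y \<Longrightarrow> y \<le> z \<Longrightarrow> x \<le> z"
    using wo unfolding less_eq_ordinal_def trans_def by blast
  show "x \<le> y \<Longrightarrow> y \<le> x \<Longrightarrow> x = y"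
    using wo unfolding less_eq_ordinal_def antisym_def by (metis Rep_ordinal_inject)
  show "x \<le> y \<or> y \<le> x"
    using wo Rep_ordinal[of x] Rep_ordinal[of y]
    unfolding less_eq_ordinal_def total_on_def refl_on_def by metis
qed

end

lemma wf_less_ordinal: "wf {(x, y :: 'a ordinal). x < y}"
proof -
  have "{(x, y :: 'a ordinal). x < y} = inv_image (ord_rel - Id) Rep_ordinal"
    by (auto simp: inv_image_def less_le less_eq_ordinal_def Rep_ordinal_inject)
  moreover have "wf (ord_rel - Id :: ('a + nat) set rel)"
    using Well_order_ord_rel unfolding well_order_on_def by blast
  ultimately show ?thesis by (simp add: wf_inv_image)
qed

instance ordinal :: (type) wellorder
proof
  fix P :: "'a ordinal \<Rightarrow> bool" and a
  assume "\<And>x. (\<And>y. y < x \<Longrightarrow> P y) \<Longrightarrow> P x"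
  then show "P a" by (rule wf_induct_rule[OF wf_less_ordinal]) simp
qed

lemma ordinal_bounded:
  fixes f :: "'a ordinal \<Rightarrow> 'a ordinal"
  shows "\<exists>\<beta>. \<forall>\<xi>\<le>\<alpha>. f \<xi> < \<beta>"
proof -
  let ?r = "ord_rel :: ('a + nat) set rel"
  have bounded: "\<exists>\<beta>. \<forall>\<xi>\<le>\<delta>. g \<xi> \<le> \<beta>" for \<delta> and g :: "'a ordinal \<Rightarrow> 'a ordinal"
  proof -
    let ?K = "(\<lambda>\<xi>. Rep_ordinal (g \<xi>)) ` {\<xi>. \<xi> \<le> \<delta>}"
    let ?U = "underS ?r (Rep_ordinal \<delta>)"
    have U: "ordLess2 (card_of ?U) ?r"
      by (rule card_of_underS[OF Card_order_ord_rel Rep_ordinal])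
    have "ordLess2 (card_of {Rep_ordinal \<delta>}) ?r"
      by (intro finite_ordLess_infinite)
        (simp_all add: Field_card_of infinite_Field_ord_rel Well_order_ord_rel card_of_well_order_on)
    then have "ordLess2 (card_of ({Rep_ordinal \<delta>} \<union> ?U)) ?r"
      by (rule card_of_Un_ordLess_infinite_Field[OF infinite_Field_ord_rel Card_order_ord_rel _ U])
    then have "ordLess2 (card_of (insert (Rep_ordinal \<delta>) ?U)) ?r" by simp
    moreover have "?K \<subseteq> (\<lambda>x. Rep_ordinal (g (Abs_ordinal x))) ` insert (Rep_ordinal \<delta>) ?U"
    proof
      fix y assume "y \<in> ?K"
      then obtain \<xi> where \<xi>: "\<xi> \<le> \<delta>" "y = Rep_ordinal (g \<xi>)" by blast
      then have "Rep_ordinal \<xi> \<in> insert (Rep_ordinal \<delta>) ?U"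
        by (auto simp: underS_def less_eq_ordinal_def)
      then show "y \<in> (\<lambda>x. Rep_ordinal (g (Abs_ordinal x))) ` insert (Rep_ordinal \<delta>) ?U"
        using \<xi> by (metis Rep_ordinal_inverse image_eqI)
    qed
    then have "ordLeq3 (card_of ?K) (card_of (insert (Rep_ordinal \<delta>) ?U))"
      by (meson card_of_image card_of_mono1 ordLeq_transitive)
    ultimately have less: "ordLess2 (card_of ?K) ?r"
      using ordLeq_ordLess_trans by blast
    have "regularCard ?r"
      unfolding ord_rel_def by (rule infinite_cardSuc_regularCard[OF infinite_base card_of_Card_order])
    moreover have "?K \<subseteq> Field ?r" using Rep_ordinal by blast
    ultimately have "\<not> cofinal ?K ?r"
      using less not_ordLess_ordIso unfolding regularCard_def by blast
    then obtain b where b: "b \<in> Field ?r" "\<forall>k\<in>?K. \<not> (b \<noteq> k \<and> (b, k) \<in> ?r)"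
      unfolding cofinal_def by blast
    have "\<forall>\<xi>\<le>\<delta>. g \<xi> \<le> Abs_ordinal b"
    proof (intro allI impI)
      fix \<xi> assume "\<xi> \<le> \<delta>"
      then have "\<not> (b \<noteq> Rep_ordinal (g \<xi>) \<and> (b, Rep_ordinal (g \<xi>)) \<in> ?r)" using b(2) by blast
      then have "\<not> Abs_ordinal b < g \<xi>"
        using b(1) by (auto simp: less_le less_eq_ordinal_def Abs_ordinal_inverse Rep_ordinal_inverse)
      then show "g \<xi> \<le> Abs_ordinal b" by simp
    qed
    then show ?thesis by blast
  qed
  have nomax: "\<exists>\<gamma>. \<beta> < \<gamma>" for \<beta> :: "'a ordinal"
  proof (rule ccontr)
    assume "\<nexists>\<gamma>. \<beta> < \<gamma>"
    then have "(Rep_ordinal \<gamma>, Rep_ordinal \<beta>) \<in> ?r" for \<gamma>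
      by (metis less_eq_ordinal_def not_less)
    then have "\<forall>x\<in>Field ?r. (x, Rep_ordinal \<beta>) \<in> ?r" by (metis Abs_ordinal_inverse)
    moreover have "\<exists>b\<in>Field ?r. Rep_ordinal \<beta> \<noteq> b \<and> (Rep_ordinal \<beta>, b) \<in> ?r"
      using infinite_Card_order_limit[OF Card_order_ord_rel infinite_Field_ord_rel Rep_ordinal] .
    moreover have "antisym ?r"
      using Well_order_ord_rel unfolding well_order_on_def linear_order_on_def partial_order_on_def
      by blast
    ultimately show False unfolding antisym_def by blast
  qed
  show ?thesis using bounded[of \<alpha> f] nomax by (meson le_less_trans)
qed

text \<open>Every well-ordering of a subset of \<open>'a\<close> is the order type of some element of \<open>'a ordinal\<close>.\<close>

lemma ordinal_represents:
  fixes r :: "'a rel"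
  assumes "Well_order r"
  shows "\<exists>(\<alpha> :: 'a ordinal) h. bij_betw h (Field r) {..<\<alpha>} \<and>
    (\<forall>x\<in>Field r. \<forall>y\<in>Field r. (x, y) \<in> r \<longleftrightarrow> h x \<le> h y)"
proof -
  let ?r = "ord_rel :: ('a + nat) set rel"
  let ?R = "Restr ?r"
  have "\<not> ordLeq3 ?r r"
  proof
    assume "ordLeq3 ?r r"
    then have "ordLeq3 (card_of (Field ?r)) (card_of (Field r))" by (rule card_of_mono2)
    also have "ordLeq3 (card_of (Field r)) (card_of (UNIV :: 'a set))" by (simp add: card_of_mono1)
    also have "ordLeq3 (card_of (UNIV :: 'a set)) (card_of (UNIV :: ('a + nat) set))"
      by (metis card_of_Plus1 UNIV_Plus_UNIV)
    finally have "ordLeq3 (card_of (Field ?r)) (card_of (UNIV :: ('a + nat) set))" .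
    moreover have "ordLess2 (card_of (UNIV :: ('a + nat) set)) ?r"
      unfolding ord_rel_def by (rule cardSuc_greater) (rule card_of_Card_order)
    moreover have "ordIso2 (card_of (Field ?r)) ?r"
      by (rule card_of_Field_ordIso) (rule Card_order_ord_rel)
    ultimately show False by (meson not_ordLess_ordLeq ordIso_symmetric ordIso_ordLeq_trans)
  qed
  then have "ordLess2 r ?r"
    using assms Well_order_ord_rel ordLess_or_ordLeq by blast
  then obtain a where a: "a \<in> Field ?r" "ordIso2 r (?R (underS ?r a))"
    using ordLess_iff_ordIso_Restr[OF Well_order_ord_rel assms] by blast
  have F: "Field (?R (underS ?r a)) = underS ?r a"
    by (metis Field_Restr_ofilter Well_order_ord_rel wo_rel.underS_ofilter wo_rel_def)
  from a(2) obtain g where "iso r (?R (underS ?r a)) g" unfolding ordIso_def by blast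
  then have g: "bij_betw g (Field r) (underS ?r a)"
      "\<And>x y. x \<in> Field r \<Longrightarrow> y \<in> Field r \<Longrightarrow> (x, y) \<in> r \<longleftrightarrow> (g x, g y) \<in> ?R (underS ?r a)"
    unfolding iso_iff2 F by blast+
  have sub: "underS ?r a \<subseteq> Field ?r" by (auto simp: underS_def Field_def)
  have "bij_betw Abs_ordinal (underS ?r a) {..< Abs_ordinal a}"
  proof (rule bij_betwI[where g = Rep_ordinal])
    show "Abs_ordinal \<in> underS ?r a \<rightarrow> {..< Abs_ordinal a}"
      using sub a(1) by (auto simp: underS_def less_le less_eq_ordinal_def Abs_ordinal_inverse
          Abs_ordinal_inject subset_iff)
    show "Rep_ordinal \<in> {..< Abs_ordinal a} \<rightarrow> underS ?r a"
      using a(1) by (auto simp: underS_def less_le less_eq_ordinal_def Abs_ordinal_inverse)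
        (metis Rep_ordinal_inverse)
  qed (use sub in \<open>auto simp: Abs_ordinal_inverse Rep_ordinal_inverse subset_iff\<close>)
  with g(1) have "bij_betw (Abs_ordinal \<circ> g) (Field r) {..< Abs_ordinal a}"
    by (rule bij_betw_trans)
  moreover have "(x, y) \<in> r \<longleftrightarrow> (Abs_ordinal \<circ> g) x \<le> (Abs_ordinal \<circ> g) y"
    if "x \<in> Field r" "y \<in> Field r" for x y
  proof -
    have "g x \<in> underS ?r a" "g y \<in> underS ?r a" using g(1) that bij_betwE by blast+
    then show ?thesis using g(2)[OF that] sub
      by (auto simp: less_eq_ordinal_def Abs_ordinal_inverse subset_iff)
  qed
  ultimately show ?thesis by blast
qed

definition osuc :: "'a ordinal \<Rightarrow> 'a ordinal" where
  "osuc \<alpha> = (LEAST \<beta>. \<alpha> < \<beta>)"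

definition is_osuc :: "'a ordinal \<Rightarrow> bool" where
  "is_osuc \<alpha> \<longleftrightarrow> (\<exists>\<beta>. \<alpha> = osuc \<beta>)"

definition opred :: "'a ordinal \<Rightarrow> 'a ordinal" where
  "opred \<alpha> = (THE \<beta>. \<alpha> = osuc \<beta>)"

definition osup :: "'a ordinal set \<Rightarrow> 'a ordinal" where
  "osup A = (LEAST \<beta>. \<forall>\<alpha>\<in>A. \<alpha> \<le> \<beta>)"

lemma less_osuc: "\<alpha> < osuc \<alpha>"
  unfolding osuc_def using ordinal_bounded[of \<alpha> id] by (metis LeastI_ex id_apply order_refl)

lemma osuc_le_iff: "osuc \<alpha> \<le> \<beta> \<longleftrightarrow> \<alpha> < \<beta>"
  unfolding osuc_def by (metis Least_le less_le_trans less_osuc osuc_def)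

lemma less_osuc_iff: "\<alpha> < osuc \<beta> \<longleftrightarrow> \<alpha> \<le> \<beta>"
  by (meson not_less osuc_le_iff)

lemma osuc_inject: "osuc \<alpha> = osuc \<beta> \<longleftrightarrow> \<alpha> = \<beta>"
  by (metis less_osuc_iff order_antisym order_refl)

lemma opred_osuc [simp]: "opred (osuc \<alpha>) = \<alpha>"
  unfolding opred_def by (auto simp: osuc_inject)

lemma is_osuc_osuc [simp]: "is_osuc (osuc \<alpha>)"
  unfolding is_osuc_def by blast

lemma opred_less: "is_osuc \<alpha> \<Longrightarrow> opred \<alpha> < \<alpha>"
  unfolding is_osuc_def using less_osuc by auto

lemma osuc_less_limit: "\<not> is_osuc \<xi> \<Longrightarrow> \<zeta> < \<xi> \<Longrightarrow> osuc \<zeta> < \<xi>"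
  by (metis is_osuc_osuc le_less osuc_le_iff)

lemma osup_least_upper_bound:
  fixes f :: "'a ordinal \<Rightarrow> 'a ordinal"
  shows "osup (f ` {..<\<xi>}) \<le> \<beta> \<longleftrightarrow> (\<forall>\<eta><\<xi>. f \<eta> \<le> \<beta>)"
proof -
  obtain \<gamma> where "\<forall>\<eta>\<le>\<xi>. f \<eta> < \<gamma>" using ordinal_bounded by blast
  then have "\<forall>\<alpha>\<in>f ` {..<\<xi>}. \<alpha> \<le> \<gamma>" by (auto simp: less_imp_le)
  then have "\<forall>\<alpha>\<in>f ` {..<\<xi>}. \<alpha> \<le> osup (f ` {..<\<xi>})"
    unfolding osup_def by (rule LeastI)
  moreover have "osup (f ` {..<\<xi>}) \<le> \<beta>" if "\<forall>\<alpha>\<in>f ` {..<\<xi>}. \<alpha> \<le> \<beta>"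
    unfolding osup_def using that by (rule Least_le)
  ultimately show ?thesis by (auto intro: order_trans)
qed

instantiation ordinal :: (type) "{zero, plus, times}"
begin

definition zero_ordinal :: "'a ordinal" where
  "zero_ordinal = (LEAST \<alpha>. True)"

function plus_ordinal :: "'a ordinal \<Rightarrow> 'a ordinal \<Rightarrow> 'a ordinal" where
  "\<alpha> + \<beta> = (if \<beta> = 0 then \<alpha>
            else if is_osuc \<beta> then osuc (\<alpha> + opred \<beta>)
            else osup ((\<lambda>\<gamma>. \<alpha> + \<gamma>) ` {..<\<beta>}))"
  by pat_completeness auto
termination
  by (relation "inv_image {(x, y). x < y} snd")
    (auto simp: wf_less_ordinal opred_less intro!: wf_inv_image)

function times_ordinal :: "'a ordinal \<Rightarrow> 'a ordinal \<Rightarrow> 'a ordinal" where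
  "\<alpha> * \<beta> = (if \<beta> = 0 then 0
            else if is_osuc \<beta> then \<alpha> * opred \<beta> + \<alpha>
            else osup ((\<lambda>\<gamma>. \<alpha> * \<gamma>) ` {..<\<beta>}))"
  by pat_completeness auto
termination
  by (relation "inv_image {(x, y). x < y} snd")
    (auto simp: wf_less_ordinal opred_less intro!: wf_inv_image)

instance ..

end

declare plus_ordinal.simps [simp del] times_ordinal.simps [simp del]

lemma zero_le_ordinal: "(0 :: 'a ordinal) \<le> \<alpha>"
  unfolding zero_ordinal_def by (simp add: Least_le)

lemma osuc_neq_0 [simp]: "osuc \<alpha> \<noteq> 0"
  by (metis less_osuc not_less zero_le_ordinal)

definition is_limit :: "'a ordinal \<Rightarrow> bool" where
  "is_limit \<xi> \<longleftrightarrow> \<xi> \<noteq> 0 \<and> \<not> is_osuc \<xi>"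

lemma plus_ordinal_0: "\<alpha> + 0 = (\<alpha> :: 'a ordinal)"
  by (subst plus_ordinal.simps) simp

lemma plus_ordinal_osuc: "\<alpha> + osuc \<beta> = osuc (\<alpha> + \<beta>)"
  by (subst plus_ordinal.simps) simp

lemma plus_ordinal_limit: "is_limit \<beta> \<Longrightarrow> \<alpha> + \<beta> = osup ((\<lambda>\<gamma>. \<alpha> + \<gamma>) ` {..<\<beta>})"
  unfolding is_limit_def by (subst plus_ordinal.simps) simp

lemma times_ordinal_0: "\<alpha> * 0 = (0 :: 'a ordinal)"
  by (subst times_ordinal.simps) simp

lemma times_ordinal_osuc: "\<alpha> * osuc \<beta> = \<alpha> * \<beta> + \<alpha>"
  by (subst times_ordinal.simps) simp

lemma times_ordinal_limit: "is_limit \<beta> \<Longrightarrow> \<alpha> * \<beta> = osup ((\<lambda>\<gamma>. \<alpha> * \<gamma>) ` {..<\<beta>})"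
  unfolding is_limit_def by (subst times_ordinal.simps) simp

function MT :: "'a ordinal \<Rightarrow> 'a ordinal list set" where
  "MT \<xi> = (if \<xi> = 0 then {[]}
           else if is_osuc \<xi> then {[]} \<union> (\<lambda>t. \<xi> # t) ` MT (opred \<xi>)
           else (\<Union>\<zeta>\<in>{..<\<xi>}. MT (osuc \<zeta>)))"
  by pat_completeness auto
termination
  by (relation "{(x, y). x < y}") (auto simp: wf_less_ordinal opred_less osuc_less_limit)

declare MT.simps [simp del]

lemma MT_0: "MT 0 = {[]}"
  by (subst MT.simps) simp

lemma MT_osuc: "MT (osuc \<xi>) = {[]} \<union> {osuc \<xi> # t | t. t \<in> MT \<xi>}"
  by (subst MT.simps) auto

lemma MT_limit: "is_limit \<xi> \<Longrightarrow> MT \<xi> = (\<Union>\<zeta>\<in>{..<\<xi>}. MT (osuc \<zeta>))"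
  unfolding is_limit_def by (subst MT.simps) simp

definition TT :: "'a ordinal \<Rightarrow> 'a ordinal list set" where
  "TT \<xi> = MT \<xi> - {[]}"

definition segments :: "'b list set \<Rightarrow> 'b list set set" where
  "segments U = {c. finite c \<and> c \<noteq> {} \<and> c \<subseteq> U - {[]} \<and>
     (\<forall>s\<in>c. \<forall>t\<in>c. s = t \<or> strict_prefix s t \<or> strict_prefix t s)}"

text \<open>
  The order on \<open>segments U \<union> {{}}\<close>.  For \<open>c = {}\<close> the second conjunct is vacuous, so \<open>{}\<close> lies
  below every segment; the first conjunct keeps anything from lying below \<open>{}\<close>.
\<close>

definition seg_less :: "'b list set \<Rightarrow> 'b list set \<Rightarrow> bool" where
  "seg_less c c' \<longleftrightarrow> c' \<noteq> {} \<and> (\<forall>s\<in>c. \<forall>t\<in>c'. strict_prefix s t)"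

definition order_preserving ::
  "'b set \<Rightarrow> ('b \<Rightarrow> 'b \<Rightarrow> bool) \<Rightarrow> 'c set \<Rightarrow> ('c \<Rightarrow> 'c \<Rightarrow> bool) \<Rightarrow> ('b \<Rightarrow> 'c) \<Rightarrow> bool" where
  "order_preserving P lessP Q lessQ f \<longleftrightarrow> f ` P \<subseteq> Q \<and> monotone_on P lessP lessQ f"

text \<open>
  The infimum is taken in the extended reals: it is \<open>-\<infinity>\<close> when the values are unbounded below, and
  \<open>\<infinity>\<close> over the empty set.
\<close>

definition small :: "'a ordinal \<Rightarrow> 'a ordinal list set \<Rightarrow> ('a ordinal list set \<Rightarrow> real) \<Rightarrow> bool" where
  "small \<zeta> \<T> f \<longleftrightarrow>
     (\<forall>i. order_preserving (TT \<zeta>) strict_prefix \<T> strict_prefix i \<longrightarrow>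
        (INF c\<in>segments (TT \<zeta>). ereal (f (i ` c))) \<le> 0)"

definition strictly_small ::
  "'a ordinal \<Rightarrow> 'a ordinal list set \<Rightarrow> ('a ordinal list set \<Rightarrow> real) \<Rightarrow> bool" where
  "strictly_small \<zeta> \<T> f \<longleftrightarrow> small \<zeta> \<T> f \<and>
     (\<forall>i. order_preserving (TT \<zeta>) strict_prefix \<T> strict_prefix i \<longrightarrow>
        (\<exists>c\<in>segments (TT \<zeta>). ereal (f (i ` c)) = (INF c\<in>segments (TT \<zeta>). ereal (f (i ` c)))))"

end

theory Submission
  imports Defs
begin

text \<open>
  The tree \<open>TT (\<zeta> * osuc \<xi>)\<close> is \<open>TT (\<zeta> * \<xi> + \<zeta>)\<close>.  It contains a copy of \<open>TT \<zeta>\<close>, and above each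
  node of this copy there is an order preserving image of \<open>TT (\<zeta> * \<xi>)\<close>
  (\<open>shift_tree_hom\<close>, \<open>tree_hom_above_shift\<close>).  Smallness,
  applied to the copy of \<open>TT \<zeta>\<close>, gives a segment on which \<open>f {}\<close> is almost nonpositive; this segment
  is the value of \<open>j\<close> at the root \<open>[osuc \<xi>]\<close> of \<open>TT (osuc \<xi>)\<close>.  The rest of \<open>j\<close> is built recursively
  in the image of \<open>TT (\<zeta> * \<xi>)\<close> above the largest node of the segment.  The recursion
  yields bounds on \<open>f (j s) (j t)\<close> only for \<open>s \<noteq> []\<close>; the monotonicity of \<open>f\<close> in its first argument
  turns the bound for \<open>s = [osuc \<xi>]\<close> into the one for \<open>s = []\<close>.
  At a limit \<open>\<xi>\<close> the tree \<open>TT \<xi>\<close> is the disjoint union of mutually incomparable trees \<open>TT (osuc \<eta>)\<close> with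
  \<open>\<eta> < \<xi>\<close>, each \<open>TT (\<zeta> * osuc \<eta>)\<close> maps into \<open>TT (\<zeta> * \<xi>)\<close>, and the maps \<open>j\<close> are glued.

  For the induction (\<open>exists_segment_map\<close>) the functions \<open>f c\<close> and their domain stay fixed.  What
  varies is an order preserving map \<open>h\<close> of \<open>TT (\<zeta> * \<xi>)\<close> into that domain, the segment or empty set \<open>c0\<close> below the
  range of \<open>h\<close> at which \<open>j\<close> starts, and the number \<open>n\<close> of levels already used.
  The two assertions of the theorem differ only in the bounds that smallness, respectively strict
  smallness, provides for a single segment.
\<close>

section \<open>Ordinal arithmetic\<close>

lemma ordinal_induct [case_names zero osuc limit]:
  fixes \<xi> :: "'a ordinal"
  assumes "P 0"
    and "\<And>\<eta>. P \<eta> \<Longrightarrow> P (osuc \<eta>)"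
    and "\<And>\<eta>. is_limit \<eta> \<Longrightarrow> (\<And>\<beta>. \<beta> < \<eta> \<Longrightarrow> P \<beta>) \<Longrightarrow> P \<eta>"
  shows "P \<xi>"
proof (induction \<xi> rule: less_induct)
  case (less \<xi>)
  show ?case
  proof (cases "is_limit \<xi>")
    case True
    then show ?thesis using assms(3) less by blast
  next
    case False
    then consider "\<xi> = 0" | \<eta> where "\<xi> = osuc \<eta>"
      unfolding is_limit_def is_osuc_def by blast
    then show ?thesis
      using assms(1,2) less less_osuc by cases auto
  qed
qed

lemma zero_less_limit: "is_limit \<beta> \<Longrightarrow> 0 < (\<beta> :: 'a ordinal)"
  unfolding is_limit_def using zero_le_ordinal[of \<beta>] by auto

lemma plus_less_plus_limit:
  fixes \<alpha> \<beta> :: "'a ordinal"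
  assumes "is_limit \<beta>" "\<eta> < \<beta>"
  shows "\<alpha> + \<eta> < \<alpha> + \<beta>"
proof -
  have "osuc \<eta> < \<beta>" using assms osuc_less_limit unfolding is_limit_def by blast
  then have "\<alpha> + osuc \<eta> \<le> \<alpha> + \<beta>"
    using osup_least_upper_bound[of "(+) \<alpha>" \<beta> "\<alpha> + \<beta>"] plus_ordinal_limit[OF assms(1), of \<alpha>] by auto
  then show ?thesis by (simp add: plus_ordinal_osuc osuc_le_iff)
qed

lemma is_limit_plus:
  fixes \<alpha> \<beta> :: "'a ordinal"
  assumes "is_limit \<beta>"
  shows "is_limit (\<alpha> + \<beta>)"
proof -
  have "\<alpha> + \<beta> \<noteq> 0"
    using plus_less_plus_limit[OF assms zero_less_limit[OF assms], of \<alpha>] zero_le_ordinal[of "\<alpha> + 0"]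
    by auto
  moreover have "\<alpha> + \<beta> \<noteq> osuc \<gamma>" for \<gamma>
  proof
    assume eq: "\<alpha> + \<beta> = osuc \<gamma>"
    then have "\<not> osup ((+) \<alpha> ` {..<\<beta>}) \<le> \<gamma>"
      using plus_ordinal_limit[OF assms, of \<alpha>] less_osuc[of \<gamma>] by simp
    then obtain \<eta> where "\<eta> < \<beta>" "\<gamma> < \<alpha> + \<eta>"
      using osup_least_upper_bound[of "(+) \<alpha>" \<beta> \<gamma>] by (auto simp: not_le)
    then show False
      using plus_less_plus_limit[OF assms, of \<eta> \<alpha>] eq by (auto simp: less_osuc_iff)
  qed
  ultimately show ?thesis unfolding is_limit_def is_osuc_def by blast
qed

lemma le_plus_ordinal: "(\<alpha> :: 'a ordinal) \<le> \<alpha> + \<beta>"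
proof (induction \<beta> rule: ordinal_induct)
  case zero
  then show ?case by (simp add: plus_ordinal_0)
next
  case (osuc \<eta>)
  then show ?case using less_osuc[of "\<alpha> + \<eta>"] by (simp add: plus_ordinal_osuc)
next
  case (limit \<eta>)
  then show ?case
    using plus_less_plus_limit[OF limit(1) zero_less_limit[OF limit(1)], of \<alpha>]
    by (simp add: plus_ordinal_0)
qed

lemma times_le_times_limit:
  fixes \<alpha> \<beta> :: "'a ordinal"
  assumes "is_limit \<beta>" "\<eta> < \<beta>"
  shows "\<alpha> * \<eta> \<le> \<alpha> * \<beta>"
  using osup_least_upper_bound[of "(*) \<alpha>" \<beta> "\<alpha> * \<beta>"] times_ordinal_limit[OF assms(1), of \<alpha>] assms(2)
  by auto

section \<open>Order preserving maps between minimal trees\<close>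

lemma Nil_in_MT: "[] \<in> MT \<xi>"
proof (induction \<xi> rule: ordinal_induct)
  case (limit \<eta>)
  then show ?case
    using MT_limit[OF limit(1)] zero_less_limit[OF limit(1)] by (auto simp: MT_osuc)
qed (simp_all add: MT_0 MT_osuc)

lemma MT_osuc_subset_limit: "is_limit \<beta> \<Longrightarrow> \<eta> < \<beta> \<Longrightarrow> MT (osuc \<eta>) \<subseteq> MT \<beta>"
  using MT_limit by blast

lemma Cons_in_MT_osuc_iff: "x # t \<in> MT (osuc \<xi>) \<longleftrightarrow> x = osuc \<xi> \<and> t \<in> MT \<xi>"
  by (simp add: MT_osuc)

text \<open>
  The branches of a limit tree are told apart by their first entry: a nonempty node lies in exactly
  one tree \<open>MT (osuc \<eta>)\<close>, and \<open>\<eta>\<close> can be read off from it.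
\<close>

lemma MT_limit_branch:
  assumes "is_limit \<xi>" "t \<in> MT \<xi>" "t \<noteq> []"
  shows "opred (hd t) < \<xi>" "t \<in> MT (osuc (opred (hd t)))"
proof -
  obtain \<eta> where "\<eta> < \<xi>" "t \<in> MT (osuc \<eta>)" using assms MT_limit by blast
  then show "opred (hd t) < \<xi>" "t \<in> MT (osuc (opred (hd t)))"
    using assms(3) by (auto simp: MT_osuc)
qed

abbreviation tree_hom :: "'b list set \<Rightarrow> 'c list set \<Rightarrow> ('b list \<Rightarrow> 'c list) \<Rightarrow> bool" where
  "tree_hom S U h \<equiv> order_preserving S strict_prefix U strict_prefix h"

lemma Nil_notin_TT: "[] \<notin> TT \<xi>"
  by (simp add: TT_def)

lemma order_preservingI:
  assumes "\<And>x. x \<in> P \<Longrightarrow> f x \<in> Q"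
    and "\<And>x y. x \<in> P \<Longrightarrow> y \<in> P \<Longrightarrow> R x y \<Longrightarrow> R' (f x) (f y)"
  shows "order_preserving P R Q R' f"
  using assms unfolding order_preserving_def monotone_on_def by blast

lemma order_preserving_in: "order_preserving P R Q R' f \<Longrightarrow> x \<in> P \<Longrightarrow> f x \<in> Q"
  unfolding order_preserving_def by blast

lemma order_preserving_mono:
  "order_preserving P R Q R' f \<Longrightarrow> x \<in> P \<Longrightarrow> y \<in> P \<Longrightarrow> R x y \<Longrightarrow> R' (f x) (f y)"
  unfolding order_preserving_def monotone_on_def by blast

lemma order_preserving_comp:
  assumes "order_preserving P R Q R' f" "order_preserving Q R' W R'' g"
  shows "order_preserving P R W R'' (g \<circ> f)"
  using assms unfolding order_preserving_def monotone_on_def by (auto simp: image_subset_iff)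

lemma tree_hom_Cons_TT: "tree_hom (TT \<xi>) (TT (osuc \<xi>)) ((#) (osuc \<xi>))"
  by (rule order_preservingI) (auto simp: TT_def Cons_in_MT_osuc_iff)

text \<open>
  The trees \<open>MT \<alpha>\<close> do not increase with \<open>\<alpha>\<close>, because a nonempty node of a successor tree must begin with the index
  of that tree.  Prepending this index repairs the map when \<open>\<beta>\<close> grows by one; it also moves \<open>TT \<alpha>\<close>
  into the branch \<open>TT (osuc \<alpha>)\<close> of a limit tree.
\<close>

lemma exists_tree_hom_TT:
  fixes \<alpha> \<beta> :: "'a ordinal"
  assumes "\<alpha> \<le> \<beta>"
  shows "\<exists>h. tree_hom (TT \<alpha>) (TT \<beta>) h"
  using assms
proof (induction \<beta> rule: ordinal_induct)
  case zero
  then have "\<alpha> = 0" using zero_le_ordinal[of \<alpha>] by simp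
  then show ?case by (intro exI[of _ id] order_preservingI) auto
next
  case (osuc \<eta>)
  show ?case
  proof (cases "\<alpha> = osuc \<eta>")
    case True
    then show ?thesis by (intro exI[of _ id] order_preservingI) auto
  next
    case False
    then have "\<alpha> \<le> \<eta>" using osuc.prems less_osuc_iff[of \<alpha> \<eta>] by (simp add: less_le)
    then obtain h where "tree_hom (TT \<alpha>) (TT \<eta>) h" using osuc.IH by blast
    then show ?thesis using order_preserving_comp tree_hom_Cons_TT by blast
  qed
next
  case (limit \<beta>)
  show ?case
  proof (cases "\<alpha> = \<beta>")
    case True
    then show ?thesis by (intro exI[of _ id] order_preservingI) auto
  next
    case False
    then have "MT (osuc \<alpha>) \<subseteq> MT \<beta>" using limit.prems MT_osuc_subset_limit[OF limit(1), of \<alpha>] by simp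
    then have "TT (osuc \<alpha>) \<subseteq> TT \<beta>" by (auto simp: TT_def)
    then have "tree_hom (TT \<alpha>) (TT \<beta>) ((#) (osuc \<alpha>))"
      using tree_hom_Cons_TT[of \<alpha>] unfolding order_preserving_def by blast
    then show ?thesis by blast
  qed
qed

lemma shift_in_MT: "t \<in> MT \<zeta> \<Longrightarrow> map ((+) \<alpha>) t \<in> MT (\<alpha> + \<zeta>)"
proof (induction \<zeta> arbitrary: t rule: ordinal_induct)
  case zero
  then show ?case by (simp add: MT_0 Nil_in_MT)
next
  case (osuc \<eta>)
  then show ?case by (auto simp: MT_osuc plus_ordinal_osuc)
next
  case (limit \<zeta>)
  then obtain \<eta> where \<eta>: "\<eta> < \<zeta>" "t \<in> MT (osuc \<eta>)" using MT_limit by blast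
  then have "map ((+) \<alpha>) t \<in> MT (osuc (\<alpha> + \<eta>))"
    using limit(1,2) osuc_less_limit plus_ordinal_osuc unfolding is_limit_def by metis
  then show ?case
    using MT_osuc_subset_limit is_limit_plus plus_less_plus_limit limit(1) \<eta>(1) by blast
qed

text \<open>
  Adding \<open>\<alpha>\<close> on the left to every entry places \<open>TT \<zeta>\<close> at the bottom of \<open>TT (\<alpha> + \<zeta>)\<close>, since
  \<open>(+) \<alpha>\<close> commutes with \<open>osuc\<close> and preserves limits.
\<close>

lemma shift_tree_hom: "tree_hom (TT \<zeta>) (TT (\<alpha> + \<zeta>)) (map ((+) \<alpha>))"
proof (rule order_preservingI)
  show "map ((+) \<alpha>) s \<in> TT (\<alpha> + \<zeta>)" if "s \<in> TT \<zeta>" for s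
    using that shift_in_MT by (auto simp: TT_def)
  show "strict_prefix (map ((+) \<alpha>) s) (map ((+) \<alpha>) t)" if "strict_prefix s t" for s t
    using that by (auto simp: strict_prefix_def prefix_def)
qed

text \<open>
  The shifted tree leaves room for \<open>TT \<alpha>\<close> above each of its nodes.  A leaf \<open>t\<close> of \<open>TT \<zeta>\<close> can simply be
  continued with the nodes of \<open>TT \<alpha>\<close>; at an inner node one first has to descend to a tree
  of smaller index, which is what \<open>exists_tree_hom_TT\<close> does.  The node \<open>t = []\<close> is
  included because the induction on \<open>\<zeta>\<close> removes the first entry of \<open>t\<close>, which may be its only one.
\<close>

lemma tree_hom_above_shift:
  fixes \<alpha> \<zeta> :: "'a ordinal"
  assumes "t \<in> MT \<zeta>"
  shows "\<exists>h. tree_hom (TT \<alpha>) (TT (\<alpha> + \<zeta>)) h \<and> (\<forall>u\<in>TT \<alpha>. strict_prefix (map ((+) \<alpha>) t) (h u))"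
proof -
  have root: "\<exists>h. tree_hom (TT \<alpha>) (TT (\<alpha> + \<zeta>)) h \<and> (\<forall>u\<in>TT \<alpha>. strict_prefix (map ((+) \<alpha>) t) (h u))"
    if "t = []" for \<zeta> :: "'a ordinal" and t :: "'a ordinal list"
  proof -
    obtain h where h: "tree_hom (TT \<alpha>) (TT (\<alpha> + \<zeta>)) h"
      using exists_tree_hom_TT le_plus_ordinal by blast
    then have "\<forall>u\<in>TT \<alpha>. [] \<noteq> h u"
      using order_preserving_in[OF h] Nil_notin_TT by metis
    then show ?thesis using h that by (intro exI[of _ h]) (simp add: strict_prefix_def)
  qed
  show ?thesis
    using assms
  proof (induction \<zeta> arbitrary: t rule: ordinal_induct)
    case zero
    then show ?case using root by (simp add: MT_0)
  next
    case (osuc \<eta>)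
    show ?case
    proof (cases t)
      case Nil
      then show ?thesis using root by blast
    next
      case (Cons x t')
      then have x: "x = osuc \<eta>" "t' \<in> MT \<eta>" using osuc.prems Cons_in_MT_osuc_iff by auto
      then obtain h where h: "tree_hom (TT \<alpha>) (TT (\<alpha> + \<eta>)) h"
          "\<forall>u\<in>TT \<alpha>. strict_prefix (map ((+) \<alpha>) t') (h u)"
        using osuc.IH by blast
      have "tree_hom (TT \<alpha>) (TT (\<alpha> + osuc \<eta>)) ((#) (osuc (\<alpha> + \<eta>)) \<circ> h)"
        unfolding plus_ordinal_osuc using order_preserving_comp[OF h(1) tree_hom_Cons_TT] .
      moreover have "\<forall>u\<in>TT \<alpha>. strict_prefix (map ((+) \<alpha>) t) (((#) (osuc (\<alpha> + \<eta>)) \<circ> h) u)"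
        using h(2) by (simp add: Cons x plus_ordinal_osuc)
      ultimately show ?thesis by blast
    qed
  next
    case (limit \<zeta>)
    then obtain \<eta> where \<eta>: "\<eta> < \<zeta>" "t \<in> MT (osuc \<eta>)" using MT_limit by blast
    then have "osuc \<eta> < \<zeta>" using limit(1) osuc_less_limit unfolding is_limit_def by blast
    then obtain h where h: "tree_hom (TT \<alpha>) (TT (\<alpha> + osuc \<eta>)) h"
        "\<forall>u\<in>TT \<alpha>. strict_prefix (map ((+) \<alpha>) t) (h u)"
      using limit(2) \<eta>(2) by blast
    have "MT (\<alpha> + osuc \<eta>) \<subseteq> MT (\<alpha> + \<zeta>)"
      unfolding plus_ordinal_osuc
      using MT_osuc_subset_limit is_limit_plus plus_less_plus_limit limit(1) \<eta>(1) by blast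
    then have "TT (\<alpha> + osuc \<eta>) \<subseteq> TT (\<alpha> + \<zeta>)" by (auto simp: TT_def)
    then have "tree_hom (TT \<alpha>) (TT (\<alpha> + \<zeta>)) h"
      using h(1) unfolding order_preserving_def by blast
    then show ?case using h(2) by blast
  qed
qed

section \<open>Segments\<close>

lemma seg_less_trans: "seg_less a b \<Longrightarrow> seg_less b c \<Longrightarrow> seg_less a c"
  unfolding seg_less_def by (meson equals0I prefix_order.less_trans)

lemma segments_image:
  assumes "tree_hom S U h" "[] \<notin> U" "c \<in> segments S"
  shows "h ` c \<in> segments U"
proof -
  have c: "finite c" "c \<noteq> {}" "c \<subseteq> S"
      "\<And>s t. s \<in> c \<Longrightarrow> t \<in> c \<Longrightarrow> s = t \<or> strict_prefix s t \<or> strict_prefix t s"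
    using assms(3) unfolding segments_def by blast+
  then have "h s = h t \<or> strict_prefix (h s) (h t) \<or> strict_prefix (h t) (h s)"
    if "s \<in> c" "t \<in> c" for s t
    using c(4)[OF that] order_preserving_mono[OF assms(1)] c(3) that by blast
  moreover have "h ` c \<subseteq> U - {[]}"
    using assms(1,2) c(3) unfolding order_preserving_def by (auto simp: image_subset_iff)
  ultimately show ?thesis using c(1,2) unfolding segments_def by simp
qed

lemma segment_has_largest:
  assumes "c \<in> segments U"
  obtains t where "t \<in> c" "\<And>s. s \<in> c \<Longrightarrow> prefix s t"
proof -
  have c: "finite c" "c \<noteq> {}"
      "\<And>s t. s \<in> c \<Longrightarrow> t \<in> c \<Longrightarrow> s = t \<or> strict_prefix s t \<or> strict_prefix t s"
    using assms unfolding segments_def by blast+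
  have "Max (length ` c) \<in> length ` c" using c(1,2) by simp
  then obtain t where t: "t \<in> c" "length t = Max (length ` c)" by auto
  have "prefix s t" if "s \<in> c" for s
  proof -
    have "length s \<le> length t" using that t(2) c(1) by simp
    then show ?thesis using c(3)[OF that t(1)] prefix_length_less[of t s] by auto
  qed
  then show ?thesis using that t(1) by blast
qed

section \<open>The inductive construction\<close>

text \<open>
  The bound for a pair \<open>s \<prec> t\<close> depends on the length of \<open>t\<close> in the original tree, so \<open>n\<close> counts
  the entries removed from the front of \<open>t\<close> at successor steps.  Starting at an arbitrary \<open>c0\<close>
  makes the recursive call usable above the segment just chosen.
\<close>

lemma exists_segment_map:
  fixes \<zeta> \<xi> :: "'a ordinal" and U :: "'b list set"
    and f :: "'b list set \<Rightarrow> 'b list set \<Rightarrow> real" and \<epsilon> :: "nat \<Rightarrow> real"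
  assumes Nil: "[] \<notin> U"
    and mono: "\<And>c c' c1. c \<in> segments U \<union> {{}} \<Longrightarrow> c' \<in> segments U \<union> {{}} \<Longrightarrow> seg_less c c' \<Longrightarrow>
      c1 \<in> segments U \<Longrightarrow> f c c1 \<le> f c' c1"
    and bound: "\<And>c i k. c \<in> segments U \<union> {{}} \<Longrightarrow> tree_hom (TT \<zeta>) U i \<Longrightarrow>
      \<exists>d\<in>segments (TT \<zeta>). f c (i ` d) \<le> \<epsilon> k"
    and h: "tree_hom (TT (\<zeta> * \<xi>)) U h"
    and c0: "c0 \<in> segments U \<union> {{}}"
    and below: "\<And>s u. s \<in> c0 \<Longrightarrow> u \<in> TT (\<zeta> * \<xi>) \<Longrightarrow> strict_prefix s (h u)"
  shows "\<exists>j. order_preserving (MT \<xi>) strict_prefix (segments U \<union> {{}}) seg_less j \<and> j [] = c0 \<and>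
    (\<forall>s\<in>MT \<xi>. \<forall>t\<in>MT \<xi>. strict_prefix s t \<longrightarrow> f (j s) (j t) \<le> \<epsilon> (n + length t))"
  using h c0 below
proof (induction \<xi> arbitrary: n h c0 rule: ordinal_induct)
  case zero
  then show ?case by (intro exI[of _ "\<lambda>_. c0"]) (auto simp: MT_0 intro!: order_preservingI)
next
  case (osuc \<xi>)
  let ?shift = "map ((+) (\<zeta> * \<xi>)) :: 'a ordinal list \<Rightarrow> 'a ordinal list"
  note hom = osuc.prems(1)[unfolded times_ordinal_osuc]
  note shift = order_preserving_comp[OF shift_tree_hom hom]
  obtain d where d: "d \<in> segments (TT \<zeta>)" "f c0 ((h \<circ> ?shift) ` d) \<le> \<epsilon> (n + 1)"
    using bound[OF osuc.prems(2) shift] by blast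
  define c1 where "c1 = (h \<circ> ?shift) ` d"
  have c1: "c1 \<in> segments U" unfolding c1_def using segments_image[OF shift Nil d(1)] .
  have d_sub: "d \<subseteq> TT \<zeta>" using d(1) unfolding segments_def by blast
  have "strict_prefix s u" if "s \<in> c0" "u \<in> c1" for s u
    using that osuc.prems(3) d_sub order_preserving_in[OF shift_tree_hom]
    unfolding c1_def times_ordinal_osuc by fastforce
  moreover have "c1 \<noteq> {}" using c1 unfolding segments_def by blast
  ultimately have c0_c1: "seg_less c0 c1" unfolding seg_less_def by blast
  \<comment> \<open>A node above the image of the largest node of \<open>d\<close> lies above the whole segment \<open>c1\<close>.\<close>
  obtain t where t: "t \<in> d" "\<And>s. s \<in> d \<Longrightarrow> prefix s t"
    using segment_has_largest[OF d(1)] by metis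
  then have "t \<in> MT \<zeta>" using d_sub by (auto simp: TT_def)
  then obtain g where g: "tree_hom (TT (\<zeta> * \<xi>)) (TT (\<zeta> * \<xi> + \<zeta>)) g"
      "\<And>u. u \<in> TT (\<zeta> * \<xi>) \<Longrightarrow> strict_prefix (?shift t) (g u)"
    using tree_hom_above_shift by blast
  have above: "strict_prefix s ((h \<circ> g) u)" if "s \<in> c1" "u \<in> TT (\<zeta> * \<xi>)" for s u
  proof -
    obtain r where r: "r \<in> d" "s = h (?shift r)" using \<open>s \<in> c1\<close> unfolding c1_def by auto
    have "prefix (?shift r) (?shift t)" using t(2)[OF r(1)] by (rule map_mono_prefix)
    then have "strict_prefix (?shift r) (g u)"
      using g(2)[OF that(2)] prefix_order.le_less_trans by blast
    moreover have "?shift r \<in> TT (\<zeta> * \<xi> + \<zeta>)"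
      using order_preserving_in[OF shift_tree_hom] r(1) d_sub by blast
    ultimately show ?thesis
      using order_preserving_mono[OF hom _ order_preserving_in[OF g(1) that(2)]] r(2) by simp
  qed
  obtain j' where j': "order_preserving (MT \<xi>) strict_prefix (segments U \<union> {{}}) seg_less j'"
      "j' [] = c1"
      "\<And>s t. s \<in> MT \<xi> \<Longrightarrow> t \<in> MT \<xi> \<Longrightarrow> strict_prefix s t \<Longrightarrow>
        f (j' s) (j' t) \<le> \<epsilon> (Suc n + length t)"
    using osuc.IH[OF order_preserving_comp[OF g(1) hom], of c1 "Suc n"] c1 above by blast
  have c1_j': "seg_less c1 (j' u)" "j' u \<in> segments U" if "u \<in> MT \<xi>" "u \<noteq> []" for u
  proof -
    show "seg_less c1 (j' u)"
      using order_preserving_mono[OF j'(1) Nil_in_MT that(1)] that(2) j'(2)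
      by (simp add: strict_prefix_def)
    then show "j' u \<in> segments U"
      using order_preserving_in[OF j'(1) that(1)] unfolding seg_less_def by blast
  qed
  define j where "j t = (case t of [] \<Rightarrow> c0 | x # u \<Rightarrow> j' u)" for t :: "'a ordinal list"
  \<comment> \<open>The bounds from the recursive call concern \<open>f c1\<close>; monotonicity carries them over to \<open>f c0\<close>.\<close>
  have c0_j': "seg_less c0 (j' u)" "f c0 (j' u) \<le> \<epsilon> (Suc n + length u)" if "u \<in> MT \<xi>" for u
  proof -
    show "seg_less c0 (j' u)"
      using c0_c1 c1_j'[OF that] seg_less_trans j'(2) by (cases "u = []") auto
    show "f c0 (j' u) \<le> \<epsilon> (Suc n + length u)"
    proof (cases "u = []")
      case True
      then show ?thesis using d(2) j'(2) unfolding c1_def by simp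
    next
      case False
      have "f c0 (j' u) \<le> f c1 (j' u)"
        using mono osuc.prems(2) c1 c0_c1 c1_j'(2)[OF that False] by blast
      also have "\<dots> \<le> \<epsilon> (Suc n + length u)"
        using j'(3)[OF Nil_in_MT that] False j'(2) by (simp add: strict_prefix_def)
      finally show ?thesis .
    qed
  qed
  have j: "seg_less (j s) (j t) \<and> f (j s) (j t) \<le> \<epsilon> (n + length t)"
    if st: "s \<in> MT (osuc \<xi>)" "t \<in> MT (osuc \<xi>)" "strict_prefix s t" for s t
  proof -
    obtain u where u: "t = osuc \<xi> # u" "u \<in> MT \<xi>"
      using st(2,3) by (cases t) (auto simp: Cons_in_MT_osuc_iff)
    show ?thesis
    proof (cases s)
      case Nil
      then show ?thesis using c0_j'[OF u(2)] by (simp add: j_def u(1))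
    next
      case (Cons x r)
      then have "r \<in> MT \<xi>" "strict_prefix r u" using st u(1) by (auto simp: Cons_in_MT_osuc_iff)
      then show ?thesis
        using order_preserving_mono[OF j'(1)] j'(3) u by (simp add: j_def Cons)
    qed
  qed
  have j_in: "j s \<in> segments U \<union> {{}}" if "s \<in> MT (osuc \<xi>)" for s
    using that osuc.prems(2) order_preserving_in[OF j'(1)] unfolding j_def
    by (cases s) (simp_all add: Cons_in_MT_osuc_iff)
  have "order_preserving (MT (osuc \<xi>)) strict_prefix (segments U \<union> {{}}) seg_less j"
    by (rule order_preservingI) (rule j_in, assumption, rule conjunct1[OF j], assumption+)
  moreover have "j [] = c0" by (simp add: j_def)
  ultimately show ?case using j by blast
next
  case (limit \<xi>)
  have "\<exists>j. order_preserving (MT (osuc \<eta>)) strict_prefix (segments U \<union> {{}}) seg_less j \<and>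
      j [] = c0 \<and> (\<forall>s\<in>MT (osuc \<eta>). \<forall>t\<in>MT (osuc \<eta>). strict_prefix s t \<longrightarrow>
        f (j s) (j t) \<le> \<epsilon> (n + length t))" if "\<eta> < \<xi>" for \<eta>
  proof -
    have less: "osuc \<eta> < \<xi>" using that limit(1) osuc_less_limit unfolding is_limit_def by blast
    then obtain e where e: "tree_hom (TT (\<zeta> * osuc \<eta>)) (TT (\<zeta> * \<xi>)) e"
      using exists_tree_hom_TT times_le_times_limit[OF limit(1)] by blast
    show ?thesis
      using limit(2)[OF less order_preserving_comp[OF e limit.prems(1)] limit.prems(2)]
        limit.prems(3) order_preserving_in[OF e] by simp
  qed
  then obtain J where J:
      "\<And>\<eta>. \<eta> < \<xi> \<Longrightarrow>
        order_preserving (MT (osuc \<eta>)) strict_prefix (segments U \<union> {{}}) seg_less (J \<eta>)"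
      "\<And>\<eta>. \<eta> < \<xi> \<Longrightarrow> J \<eta> [] = c0"
      "\<And>\<eta> s t. \<eta> < \<xi> \<Longrightarrow> s \<in> MT (osuc \<eta>) \<Longrightarrow> t \<in> MT (osuc \<eta>) \<Longrightarrow> strict_prefix s t \<Longrightarrow>
        f (J \<eta> s) (J \<eta> t) \<le> \<epsilon> (n + length t)"
    by metis
  \<comment> \<open>All the maps \<open>J \<eta>\<close> agree at \<open>[]\<close>, the only node that two branches share.\<close>
  define j where "j t = (if t = [] then c0 else J (opred (hd t)) t)" for t
  have j: "seg_less (j s) (j t) \<and> f (j s) (j t) \<le> \<epsilon> (n + length t)"
    if "s \<in> MT \<xi>" "t \<in> MT \<xi>" "strict_prefix s t" for s t
  proof -
    let ?\<eta> = "opred (hd t)"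
    have "t \<noteq> []" using that(3) by auto
    note t = this MT_limit_branch[OF limit(1) that(2) this]
    have "s \<in> MT (osuc ?\<eta>) \<and> j s = J ?\<eta> s"
    proof (cases "s = []")
      case True
      then show ?thesis using J(2) t(2) Nil_in_MT by (simp add: j_def)
    next
      case False
      then have "hd s = hd t" using that(3) by (auto simp: strict_prefix_def prefix_def)
      then show ?thesis
        using MT_limit_branch[OF limit(1) that(1) False] False by (simp add: j_def)
    qed
    moreover have "j t = J ?\<eta> t" using t(1) by (simp add: j_def)
    ultimately show ?thesis
      using J(3)[OF t(2)] order_preserving_mono[OF J(1)[OF t(2)]] t(3) that(3) by simp
  qed
  have j_in: "j s \<in> segments U \<union> {{}}" if "s \<in> MT \<xi>" for s
  proof (cases "s = []")
    case True
    then show ?thesis using limit.prems(2) by (simp add: j_def)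
  next
    case False
    note branch = MT_limit_branch[OF limit(1) that False]
    show ?thesis using order_preserving_in[OF J(1)[OF branch(1)] branch(2)] False by (simp add: j_def)
  qed
  have "order_preserving (MT \<xi>) strict_prefix (segments U \<union> {{}}) seg_less j"
    by (rule order_preservingI) (rule j_in, assumption, rule conjunct1[OF j], assumption+)
  moreover have "j [] = c0" by (simp add: j_def)
  ultimately show ?case using j by blast
qed

theorem lemma3p2:
  fixes \<zeta> \<xi> :: "'a ordinal"
    and f :: "'a ordinal list set \<Rightarrow> 'a ordinal list set \<Rightarrow> real"
  assumes "\<zeta> > 0"
    and "\<And>c. c \<in> segments (TT (\<zeta> * \<xi>)) \<union> {{}} \<Longrightarrow> small \<zeta> (TT (\<zeta> * \<xi>)) (f c)"
    and "\<And>c c' c1. c \<in> segments (TT (\<zeta> * \<xi>)) \<union> {{}} \<Longrightarrow> c' \<in> segments (TT (\<zeta> * \<xi>)) \<union> {{}} \<Longrightarrow>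
           seg_less c c' \<Longrightarrow> c1 \<in> segments (TT (\<zeta> * \<xi>)) \<Longrightarrow> f c c1 \<le> f c' c1"
  shows "(\<forall>\<epsilon> :: nat \<Rightarrow> real. (\<forall>n. 0 < \<epsilon> n \<and> \<epsilon> n < 1) \<longrightarrow>
           (\<exists>j. order_preserving (MT \<xi>) strict_prefix (segments (TT (\<zeta> * \<xi>)) \<union> {{}}) seg_less j \<and>
              j [] = {} \<and>
              (\<forall>s\<in>MT \<xi>. \<forall>t\<in>TT \<xi>. strict_prefix s t \<longrightarrow> f (j s) (j t) \<le> \<epsilon> (length t))))
       \<and> ((\<forall>c\<in>segments (TT (\<zeta> * \<xi>)) \<union> {{}}. strictly_small \<zeta> (TT (\<zeta> * \<xi>)) (f c)) \<longrightarrow>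
           (\<exists>j. order_preserving (MT \<xi>) strict_prefix (segments (TT (\<zeta> * \<xi>)) \<union> {{}}) seg_less j \<and>
              j [] = {} \<and>
              (\<forall>s\<in>MT \<xi>. \<forall>t\<in>TT \<xi>. strict_prefix s t \<longrightarrow> f (j s) (j t) \<le> 0)))"
proof (intro conjI allI impI)
  have result: "\<exists>j. order_preserving (MT \<xi>) strict_prefix (segments (TT (\<zeta> * \<xi>)) \<union> {{}}) seg_less j \<and>
      j [] = {} \<and> (\<forall>s\<in>MT \<xi>. \<forall>t\<in>TT \<xi>. strict_prefix s t \<longrightarrow> f (j s) (j t) \<le> \<epsilon> (length t))"
    if bound: "\<And>c i k. c \<in> segments (TT (\<zeta> * \<xi>)) \<union> {{}} \<Longrightarrow> tree_hom (TT \<zeta>) (TT (\<zeta> * \<xi>)) i \<Longrightarrow>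
      \<exists>d\<in>segments (TT \<zeta>). f c (i ` d) \<le> \<epsilon> k" for \<epsilon> :: "nat \<Rightarrow> real"
  proof -
    have "tree_hom (TT (\<zeta> * \<xi>)) (TT (\<zeta> * \<xi>)) id" by (rule order_preservingI) auto
    then obtain j where
        "order_preserving (MT \<xi>) strict_prefix (segments (TT (\<zeta> * \<xi>)) \<union> {{}}) seg_less j"
        "j [] = {}"
        "\<forall>s\<in>MT \<xi>. \<forall>t\<in>MT \<xi>. strict_prefix s t \<longrightarrow> f (j s) (j t) \<le> \<epsilon> (0 + length t)"
      using exists_segment_map[where U = "TT (\<zeta> * \<xi>)" and h = id and ?c0.0 = "{}" and n = 0
          and f = f and \<epsilon> = \<epsilon> and \<zeta> = \<zeta> and \<xi> = \<xi>] assms(3) bound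
      by (auto simp: TT_def)
    then show ?thesis by (auto simp: TT_def)
  qed
  {
    fix \<epsilon> :: "nat \<Rightarrow> real"
    assume \<epsilon>: "\<forall>n. 0 < \<epsilon> n \<and> \<epsilon> n < 1"
    show "\<exists>j. order_preserving (MT \<xi>) strict_prefix (segments (TT (\<zeta> * \<xi>)) \<union> {{}}) seg_less j \<and>
      j [] = {} \<and> (\<forall>s\<in>MT \<xi>. \<forall>t\<in>TT \<xi>. strict_prefix s t \<longrightarrow> f (j s) (j t) \<le> \<epsilon> (length t))"
    proof (rule result)
      fix c i k
      assume "c \<in> segments (TT (\<zeta> * \<xi>)) \<union> {{}}" "tree_hom (TT \<zeta>) (TT (\<zeta> * \<xi>)) i"
      then have "(INF d\<in>segments (TT \<zeta>). ereal (f c (i ` d))) \<le> 0"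
        using assms(2) unfolding small_def by blast
      also have "0 < ereal (\<epsilon> k)" using \<epsilon> by simp
      finally show "\<exists>d\<in>segments (TT \<zeta>). f c (i ` d) \<le> \<epsilon> k"
        unfolding INF_less_iff by (auto intro: less_imp_le)
    qed
  }
  assume strict: "\<forall>c\<in>segments (TT (\<zeta> * \<xi>)) \<union> {{}}. strictly_small \<zeta> (TT (\<zeta> * \<xi>)) (f c)"
  show "\<exists>j. order_preserving (MT \<xi>) strict_prefix (segments (TT (\<zeta> * \<xi>)) \<union> {{}}) seg_less j \<and>
      j [] = {} \<and> (\<forall>s\<in>MT \<xi>. \<forall>t\<in>TT \<xi>. strict_prefix s t \<longrightarrow> f (j s) (j t) \<le> 0)"
  proof (rule result)
    fix c i
    assume c: "c \<in> segments (TT (\<zeta> * \<xi>)) \<union> {{}}" and i: "tree_hom (TT \<zeta>) (TT (\<zeta> * \<xi>)) i"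
    have "(INF d\<in>segments (TT \<zeta>). ereal (f c (i ` d))) \<le> 0"
      using assms(2)[OF c] i unfolding small_def by blast
    moreover obtain d where "d \<in> segments (TT \<zeta>)"
        "ereal (f c (i ` d)) = (INF d\<in>segments (TT \<zeta>). ereal (f c (i ` d)))"
      using bspec[OF strict c] i unfolding strictly_small_def by blast
    ultimately show "\<exists>d\<in>segments (TT \<zeta>). f c (i ` d) \<le> 0"
      by (metis ereal_less_eq(3) zero_ereal_def)
  qed
qed

end
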